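(* Let $s\geq 2$ be a fixed integer. Let $(p_n)_{n\ge 1}$ and $(q_n)_{n\ge 1}$ be two sequences of real numbers in the open interval $(0,1)$ satisfying, for each $n$, $$p_n^s+p_n^{s-1}q_n+\cdots+q_n^s=\sum_{k=0}^{s}p_n^kq_n^{s-k}=1.$$ Let $(X_n)_{n\ge1}$ be a sequence of random variables such that each $X_n$ takes values in $\{0,1,\dots,sn\}$ and follows the bi$^s$nomial distribution $\mathcal{B}^{(s)}(n,p_n)$, i.e. $\mathbb{P}(X_n=k)=\binom{n}{k}_s p_n^k q_n^{sn-k}$ for $0\le k\le sn$. Assume that the expectations converge to a finite positive limit $\lambda_s$: $$\lim_{n\to\infty}E(X_n)=\lambda_s>0,$$ where $E(X_n)=np_n\frac{(s+1)p_n^s-1}{p_n-q_n}$ if $p_n\ne q_n$ (and $E(X_n)=sn/2$ if $p_n=q_n$). Then $(X_n)_n$ converges in law to the Poisson distribution with parameter $\lambda_s$; that is, for every integer $k\geq 0$, $$\lim_{n\to\infty}\mathbb{P}(X_n=k)=\lim_{n\to\infty}\binom{n}{k}_s p_n^kq_n^{sn-k}=\frac{\lambda_s^k}{k!}e^{-\lambda_s}.$$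
   Context: For integers $n\ge 1$, $s\ge1$, $k\ge0$, the bi$^s$nomial coefficient $\binom{n}{k}_s$ is the number of integer solutions $(x_1,\dots,x_n)$ of $x_1+\cdots+x_n=k$ with $0\le x_i\le s$ for all $i$; equivalently, the coefficient of $x^k$ in $(1+x+\cdots+x^s)^n$. The bi$^s$nomial distribution $\mathcal{B}^{(s)}(n,p)$, where $p,q\in(0,1)$ satisfy $\sum_{k=0}^s p^kq^{s-k}=1$, is the law on $\{0,\dots,sn\}$ with mass function $k\mapsto\binom{n}{k}_s p^kq^{sn-k}$. *)

theory Defs
  imports "HOL-Probability.Probability"
begin

text \<open>The number of solutions of \<open>x\<^sub>1 + \<dots> + x\<^sub>n = k\<close> with \<open>0 \<le> x\<^sub>i \<le> s\<close>. Solutions are functions on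
  \<open>{1..n}\<close>; being extensional (\<open>\<rightarrow>\<^sub>E\<close>), each is counted once.\<close>

definition bisnomial :: "nat \<Rightarrow> nat \<Rightarrow> nat \<Rightarrow> nat" where
  "bisnomial s n k = card {x \<in> {1..n} \<rightarrow>\<^sub>E {0..s}. (\<Sum>i = 1..n. x i) = k}"

end

theory Submission
  imports Defs
begin

text \<open>If the means converge then the mean of a single summand, \<open>\<Sum>j. j p^j q^(s-j)\<close>, tends to \<open>0\<close>,
  which forces \<open>p \<rightarrow> 0\<close> and \<open>q \<rightarrow> 1\<close>; then the term \<open>j = 1\<close> dominates both the mean and \<open>1 - q^s\<close>,
  so that \<open>n p\<close> and \<open>n (1 - q^s)\<close> tend to \<open>\<lambda>\<close>.  Since the bisnomial coefficient lies between
  \<open>n choose k\<close> and \<open>n + k - 1 choose k\<close>, it is asymptotic to \<open>n^k / k!\<close>, and the limit of the mass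
  function follows from \<open>(q^s)^n \<rightarrow> exp (-\<lambda>)\<close>.  On the naturals this gives convergence in law
  because every value of the distribution function is a finite sum of masses.\<close>

section \<open>Bisnomial coefficients\<close>

lemma finite_bounded_funs: "finite ({1..n::nat} \<rightarrow>\<^sub>E {0..s::nat})"
  by (intro finite_PiE) auto

text \<open>The indicator functions of the \<open>k\<close>-subsets of \<open>{1..n}\<close> are
  distinct solutions; \<open>s \<ge> 1\<close> lets a summand take the value 1.\<close>

lemma binomial_le_bisnomial:
  assumes "s \<ge> 1"
  shows "n choose k \<le> bisnomial s n k"
proof -
  define ind where "ind B = (\<lambda>i\<in>{1..n}. if i \<in> B then 1 else (0::nat))" for B
  have ind: "ind B i = (if i \<in> B then 1 else 0)" if "i \<in> {1..n}" for B i
    unfolding ind_def using that by (rule restrict_apply')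
  have "inj_on ind {B. B \<subseteq> {1..n} \<and> card B = k}"
  proof (rule inj_onI)
    fix B C
    assume B: "B \<in> {B. B \<subseteq> {1..n} \<and> card B = k}" and C: "C \<in> {B. B \<subseteq> {1..n} \<and> card B = k}"
      and eq: "ind B = ind C"
    have "i \<in> B \<longleftrightarrow> i \<in> C" if "i \<in> {1..n}" for i
      using ind[OF that, of B] ind[OF that, of C] unfolding eq by (metis zero_neq_one)
    moreover have "B \<subseteq> {1..n}" "C \<subseteq> {1..n}" using B C by simp_all
    ultimately show "B = C" by (metis subset_antisym subsetD subsetI)
  qed
  moreover have "ind ` {B. B \<subseteq> {1..n} \<and> card B = k}
    \<subseteq> {x \<in> {1..n} \<rightarrow>\<^sub>E {0..s}. (\<Sum>i = 1..n. x i) = k}"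
  proof (rule image_subsetI)
    fix B assume "B \<in> {B. B \<subseteq> {1..n} \<and> card B = k}"
    then have B: "B \<subseteq> {1..n}" "card B = k" by simp_all
    have "(\<Sum>i = 1..n. ind B i) = (\<Sum>i = 1..n. if i \<in> B then 1 else 0)"
      by (intro sum.cong refl ind)
    also have "\<dots> = card ({1..n} \<inter> B)"
      by (subst sum.If_cases) simp_all
    also have "{1..n} \<inter> B = B" using B by blast
    finally have "(\<Sum>i = 1..n. ind B i) = k" using B by simp
    moreover have "ind B \<in> {1..n} \<rightarrow>\<^sub>E {0..s}"
      unfolding ind_def using assms by simp
    ultimately show "ind B \<in> {x \<in> {1..n} \<rightarrow>\<^sub>E {0..s}. (\<Sum>i = 1..n. x i) = k}"
      by simp
  qed
  ultimately have "card {B. B \<subseteq> {1..n} \<and> card B = k} \<le> bisnomial s n k"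
    unfolding bisnomial_def
    by (rule card_inj_on_le) (rule finite_subset[OF _ finite_bounded_funs], rule Collect_restrict)
  then show ?thesis by (simp add: n_subsets)
qed

text \<open>Dropping the upper bound \<open>s\<close> leaves the weak compositions of
  \<open>k\<close> into \<open>n\<close> parts, which stars and bars counts; they are represented as
  lists of length \<open>n\<close>.\<close>

lemma bisnomial_le_multichoose: "bisnomial s n k \<le> (n + k - 1) choose k"
proof -
  let ?L = "{l :: nat list. length l = n \<and> sum_list l = k}"
  let ?lst = "\<lambda>x :: nat \<Rightarrow> nat. map x [1..<Suc n]"
  have fin: "finite ?L"
    by (rule finite_subset[OF _ finite_lists_length_eq[of "{0..k}" n]])
       (auto intro: member_le_sum_list)
  have "bisnomial s n k \<le> card ?L"
    unfolding bisnomial_def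
  proof (rule card_inj_on_le[OF _ _ fin, of ?lst])
    show "inj_on ?lst {x \<in> {1..n} \<rightarrow>\<^sub>E {0..s}. (\<Sum>i = 1..n. x i) = k}"
      by (rule inj_onI) (auto intro: PiE_ext simp: atLeastLessThanSuc_atLeastAtMost simp del: upt_Suc)
    show "?lst ` {x \<in> {1..n} \<rightarrow>\<^sub>E {0..s}. (\<Sum>i = 1..n. x i) = k} \<subseteq> ?L"
      by (auto simp: interv_sum_list_conv_sum_set_nat atLeastLessThanSuc_atLeastAtMost simp del: upt_Suc)
  qed
  also have "card ?L = (k + n - 1) choose k"
    by (rule card_length_sum_list)
  finally show ?thesis by (simp add: add.commute)
qed

text \<open>Expand the \<open>n\<close>-th power over all choices of one exponent per factor, then
  group the choices by their total \<open>k\<close>. The identity in two free variables can later be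
  differentiated in \<open>a\<close>.\<close>

lemma bisnomial_generating_function:
  fixes a b :: real
  shows "(\<Sum>k\<le>s * n. real (bisnomial s n k) * a ^ k * b ^ (s * n - k))
    = (\<Sum>j = 0..s. a ^ j * b ^ (s - j)) ^ n"
proof -
  let ?P = "{1..n} \<rightarrow>\<^sub>E {0..s}"
  have le: "(\<Sum>i = 1..n. x i) \<le> s * n" if "x \<in> ?P" for x
    using sum_bounded_above[of "{1..n}" x s] that by (auto simp: PiE_iff mult.commute)
  have "(\<Sum>j = 0..s. a ^ j * b ^ (s - j)) ^ n = (\<Prod>i = 1..n. \<Sum>j = 0..s. a ^ j * b ^ (s - j))"
    by simp
  also have "\<dots> = (\<Sum>x\<in>?P. \<Prod>i = 1..n. a ^ x i * b ^ (s - x i))"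
    by (rule prod_sum_PiE) auto
  also have "\<dots> = (\<Sum>x\<in>?P. a ^ (\<Sum>i = 1..n. x i) * b ^ (s * n - (\<Sum>i = 1..n. x i)))"
  proof (rule sum.cong[OF refl])
    fix x assume x: "x \<in> ?P"
    have "(\<Sum>i = 1..n. s - x i) = s * n - (\<Sum>i = 1..n. x i)"
      using x by (subst sum_subtractf_nat) (auto simp: mult.commute PiE_iff)
    then show "(\<Prod>i = 1..n. a ^ x i * b ^ (s - x i))
        = a ^ (\<Sum>i = 1..n. x i) * b ^ (s * n - (\<Sum>i = 1..n. x i))"
      by (simp add: prod.distrib power_sum[symmetric])
  qed
  also have "\<dots> = (\<Sum>k\<le>s * n. \<Sum>x\<in>{x \<in> ?P. (\<Sum>i = 1..n. x i) = k}.
      a ^ (\<Sum>i = 1..n. x i) * b ^ (s * n - (\<Sum>i = 1..n. x i)))"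
    using le by (intro sum.group[symmetric] finite_bounded_funs) auto
  also have "\<dots> = (\<Sum>k\<le>s * n. real (bisnomial s n k) * a ^ k * b ^ (s * n - k))"
    by (intro sum.cong refl) (simp add: bisnomial_def)
  finally show ?thesis by simp
qed

text \<open>The generating function with \<open>a\<close> replaced by \<open>t a\<close>, differentiated at \<open>t = 1\<close>.\<close>

lemma bisnomial_first_moment:
  fixes a b :: real
  shows "(\<Sum>k\<le>s * n. real k * (real (bisnomial s n k) * a ^ k * b ^ (s * n - k)))
    = real n * (\<Sum>j = 0..s. a ^ j * b ^ (s - j)) ^ (n - 1) * (\<Sum>j = 0..s. real j * a ^ j * b ^ (s - j))"
proof -
  have "((\<lambda>t. \<Sum>k\<le>s * n. real (bisnomial s n k) * (t * a) ^ k * b ^ (s * n - k)) has_real_derivative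
      (\<Sum>k\<le>s * n. real k * (real (bisnomial s n k) * a ^ k * b ^ (s * n - k)))) (at 1)"
    unfolding power_mult_distrib
    by (auto intro!: derivative_eq_intros sum.cong)
  then have "((\<lambda>t. (\<Sum>j = 0..s. (t * a) ^ j * b ^ (s - j)) ^ n) has_real_derivative
      (\<Sum>k\<le>s * n. real k * (real (bisnomial s n k) * a ^ k * b ^ (s * n - k)))) (at 1)"
    by (simp only: bisnomial_generating_function)
  moreover have "((\<lambda>t. (\<Sum>j = 0..s. (t * a) ^ j * b ^ (s - j)) ^ n) has_real_derivative
      real n * (\<Sum>j = 0..s. a ^ j * b ^ (s - j)) ^ (n - 1) * (\<Sum>j = 0..s. real j * a ^ j * b ^ (s - j))) (at 1)"
    unfolding power_mult_distrib
    by (auto intro!: derivative_eq_intros sum.cong)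
  ultimately show ?thesis by (rule DERIV_unique)
qed

text \<open>This yields the closed form of the mean of one summand; multiplying by
  \<open>a - b\<close> avoids a division. In the induction, both sums for \<open>Suc s\<close> are
  \<open>b\<close> times the sum for \<open>s\<close> plus a new top term.\<close>

lemma geometric_first_moment:
  fixes a b :: real
  shows "(a - b) * (\<Sum>j = 0..s. real j * a ^ j * b ^ (s - j))
    = a * (real (s + 1) * a ^ s - (\<Sum>j = 0..s. a ^ j * b ^ (s - j)))"
proof (induction s)
  case (Suc s)
  have A: "(\<Sum>j = 0..Suc s. a ^ j * b ^ (Suc s - j)) = b * (\<Sum>j = 0..s. a ^ j * b ^ (s - j)) + a ^ Suc s"
    by (auto simp: sum_distrib_left Suc_diff_le intro!: sum.cong)
  have B: "(\<Sum>j = 0..Suc s. real j * a ^ j * b ^ (Suc s - j))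
      = b * (\<Sum>j = 0..s. real j * a ^ j * b ^ (s - j)) + real (Suc s) * a ^ Suc s"
    by (auto simp: sum_distrib_left Suc_diff_le intro!: sum.cong)
  have "(a - b) * (b * (\<Sum>j = 0..s. real j * a ^ j * b ^ (s - j)) + real (Suc s) * a ^ Suc s)
      = b * (a * (real (s + 1) * a ^ s - (\<Sum>j = 0..s. a ^ j * b ^ (s - j))))
        + (a - b) * (real (Suc s) * a ^ Suc s)"
    unfolding Suc.IH[symmetric] by (simp add: algebra_simps)
  then show ?case unfolding A B by (simp add: algebra_simps)
qed simp

section \<open>Asymptotics\<close>

text \<open>Up to \<open>fact k\<close>, the quotient is a product of \<open>k\<close> factors
  \<open>(n + c - i) / n\<close>, each tending to 1. The shift \<open>c\<close> serves both bounds
  on the bisnomial coefficient.\<close>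

lemma binomial_shift_asymp: "(\<lambda>n. real ((n + c) choose k) / real n ^ k) \<longlonglongrightarrow> 1 / fact k"
proof -
  have "(\<lambda>n. (\<Prod>i = 0..<k. (real n + real c - real i) / real n) / fact k) \<longlonglongrightarrow> (\<Prod>i = 0..<k. 1) / fact k"
  proof (intro tendsto_intros)
    fix i
    have "(\<lambda>n. 1 + (real c - real i) * inverse (real n)) \<longlonglongrightarrow> 1 + (real c - real i) * 0"
      by (intro tendsto_intros lim_inverse_n)
    moreover have "eventually (\<lambda>n. 1 + (real c - real i) * inverse (real n)
        = (real n + real c - real i) / real n) sequentially"
      using eventually_gt_at_top[of 0] by eventually_elim (simp add: field_simps)
    ultimately show "(\<lambda>n. (real n + real c - real i) / real n) \<longlonglongrightarrow> 1"
      by (auto dest: Lim_transform_eventually)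
  qed auto
  \<comment> \<open>The subtraction is in the reals, so the product formula also covers
    \<open>n + c < k\<close>, where a factor vanishes.\<close>
  moreover have "(\<Prod>i = 0..<k. (real n + real c - real i) / real n) / fact k
      = real ((n + c) choose k) / real n ^ k" for n
    by (simp add: binomial_gbinomial gbinomial_prod_rev prod_dividef)
  ultimately show ?thesis by simp
qed

lemma bisnomial_asymp:
  assumes "s \<ge> 1"
  shows "(\<lambda>n. real (bisnomial s n k) / real n ^ k) \<longlonglongrightarrow> 1 / fact k"
proof (rule tendsto_sandwich)
  show "(\<lambda>n. real ((n + 0) choose k) / real n ^ k) \<longlonglongrightarrow> 1 / fact k"
    by (rule binomial_shift_asymp)
  show "(\<lambda>n. real ((n + (k - 1)) choose k) / real n ^ k) \<longlonglongrightarrow> 1 / fact k"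
    by (rule binomial_shift_asymp)
  show "\<forall>\<^sub>F n in sequentially. real ((n + 0) choose k) / real n ^ k \<le> real (bisnomial s n k) / real n ^ k"
    using binomial_le_bisnomial[OF assms] by (auto intro!: always_eventually divide_right_mono)
  \<comment> \<open>With truncated subtraction \<open>n + k - 1\<close> and
    \<open>n + (k - 1)\<close> may differ at \<open>k = 0\<close>, but there both binomials are
    1.\<close>
  have "bisnomial s n k \<le> (n + (k - 1)) choose k" for n
    using bisnomial_le_multichoose[of s n k] by (cases k) auto
  then show "\<forall>\<^sub>F n in sequentially.
      real (bisnomial s n k) / real n ^ k \<le> real ((n + (k - 1)) choose k) / real n ^ k"
    by (auto intro!: always_eventually divide_right_mono)
qed

text \<open>For \<open>e < 1\<close>, the inequality \<open>1 + x \<le> exp x\<close> gives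
  \<open>exp (- e / (1 - e)) \<le> 1 - e \<le> exp (- e)\<close>. The \<open>n\<close>-th powers of
  both outer terms tend to \<open>exp (- l)\<close>.\<close>

lemma tendsto_power_exp_neg:
  fixes e :: "nat \<Rightarrow> real"
  assumes lim: "(\<lambda>n. real n * e n) \<longlonglongrightarrow> l" and e0: "e \<longlonglongrightarrow> 0"
  shows "(\<lambda>n. (1 - e n) ^ n) \<longlonglongrightarrow> exp (- l)"
proof (rule tendsto_sandwich)
  have "(\<lambda>n. exp (- (real n * e n / (1 - e n)))) \<longlonglongrightarrow> exp (- (l / (1 - 0)))"
    by (intro tendsto_intros lim e0) simp
  then show "(\<lambda>n. exp (- (real n * e n / (1 - e n)))) \<longlonglongrightarrow> exp (- l)" by simp
  show "(\<lambda>n. exp (- (real n * e n))) \<longlonglongrightarrow> exp (- l)"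
    by (intro tendsto_intros lim)
  have small: "\<forall>\<^sub>F n in sequentially. e n < 1"
    using e0 by (rule order_tendstoD) simp
  then show "\<forall>\<^sub>F n in sequentially. (1 - e n) ^ n \<le> exp (- (real n * e n))"
  proof eventually_elim
    case (elim n)
    have "(1 - e n) ^ n \<le> exp (- e n) ^ n"
      using exp_ge_add_one_self[of "- e n"] elim by (intro power_mono) auto
    then show ?case by (simp add: exp_of_nat_mult[symmetric])
  qed
  show "\<forall>\<^sub>F n in sequentially. exp (- (real n * e n / (1 - e n))) \<le> (1 - e n) ^ n"
    using small
  proof eventually_elim
    case (elim n)
    \<comment> \<open>Here \<open>1 / (1 - e) = 1 + e / (1 - e)\<close>; taking reciprocals
      afterwards turns this into the lower bound.\<close>
    have "1 / (1 - e n) \<le> exp (e n / (1 - e n))"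
      using exp_ge_add_one_self[of "e n / (1 - e n)"] elim by (simp add: field_simps)
    then have "exp (- (e n / (1 - e n))) \<le> 1 - e n"
      using elim by (simp add: exp_minus field_simps)
    then have "exp (- (e n / (1 - e n))) ^ n \<le> (1 - e n) ^ n"
      by (intro power_mono) auto
    then show ?case by (simp add: exp_of_nat_mult[symmetric])
  qed
qed

text \<open>Both the mean of one summand and \<open>1 - q ^ s\<close> contain a factor
  \<open>p\<close>: they are \<open>p * g\<close> and \<open>p * h\<close> with
  \<open>h \<le> g\<close>. Hence the mean controls \<open>q\<close>, then \<open>p\<close>, and
  finally both cofactors tend to 1.\<close>

lemma bisnomial_parameters_limits:
  fixes p q :: "nat \<Rightarrow> real"
  assumes s: "s \<ge> 1"
    and pq: "\<forall>\<^sub>F n in sequentially. p n \<ge> 0 \<and> q n \<in> {0<..1} \<and> (\<Sum>k = 0..s. p n ^ k * q n ^ (s - k)) = 1"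
    and mean: "(\<lambda>n. real n * (\<Sum>j = 0..s. real j * p n ^ j * q n ^ (s - j))) \<longlonglongrightarrow> l"
  shows "q \<longlonglongrightarrow> 1" "(\<lambda>n. real n * p n) \<longlonglongrightarrow> l" "(\<lambda>n. (q n ^ s) ^ n) \<longlonglongrightarrow> exp (- l)"
proof -
  obtain r where r: "s = Suc r" using s by (cases s) auto
  define m where "m n = (\<Sum>j = 0..s. real j * p n ^ j * q n ^ (s - j))" for n
  define g where "g n = (\<Sum>j = 0..r. real (Suc j) * p n ^ j * q n ^ (r - j))" for n
  define h where "h n = (\<Sum>j = 0..r. p n ^ j * q n ^ (r - j))" for n
  have m: "m n = p n * g n" for n
    unfolding m_def g_def r
    by (subst sum.atLeast0_atMost_Suc_shift) (simp add: sum_distrib_left algebra_simps)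
  have split: "(\<Sum>k = 0..s. p n ^ k * q n ^ (s - k)) = q n ^ s + p n * h n" for n
    unfolding h_def r
    by (subst sum.atLeast0_atMost_Suc_shift) (simp add: sum_distrib_left algebra_simps)
  have "(\<lambda>n. real n * m n * inverse (real n)) \<longlonglongrightarrow> l * 0"
    using mean unfolding m_def by (intro tendsto_mult lim_inverse_n)
  moreover have "\<forall>\<^sub>F n in sequentially. real n * m n * inverse (real n) = m n"
    using eventually_gt_at_top[of 0] by eventually_elim simp
  ultimately have "m \<longlonglongrightarrow> l * 0"
    by (rule Lim_transform_eventually)
  then have m0: "m \<longlonglongrightarrow> 0" by simp
  have hg: "h n \<le> g n" if "p n \<ge> 0" "q n > 0" for n
    unfolding h_def g_def using that
    by (intro sum_mono) (auto intro!: mult_right_mono simp: mult_le_cancel_right1)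
  \<comment> \<open>The normalization gives \<open>1 - q ^ s = p * h \<le> p * g = m\<close>, and
    \<open>q ^ s \<le> q\<close> because \<open>0 < q \<le> 1\<close>.\<close>
  have q_ge: "\<forall>\<^sub>F n in sequentially. 1 - m n \<le> q n"
    using pq
  proof eventually_elim
    case (elim n)
    have "1 - m n \<le> q n ^ s"
      using elim hg[of n] unfolding split m
      by (smt (verit) greaterThanAtMost_iff mult_left_mono)
    also have "\<dots> \<le> q n"
      using elim s power_decreasing[of 1 s "q n"] by auto
    finally show ?case .
  qed
  show q1: "q \<longlonglongrightarrow> 1"
  proof (rule tendsto_sandwich[OF q_ge])
    show "\<forall>\<^sub>F n in sequentially. q n \<le> 1" using pq by eventually_elim auto
    show "(\<lambda>n. 1 - m n) \<longlonglongrightarrow> 1" using tendsto_diff[OF tendsto_const m0, of 1] by simp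
  qed simp
  have p0: "p \<longlonglongrightarrow> 0"
  proof (rule tendsto_sandwich[of "\<lambda>_. 0"])
    show "\<forall>\<^sub>F n in sequentially. 0 \<le> p n" using pq by eventually_elim auto
    \<comment> \<open>The term \<open>j = 0\<close> of \<open>g\<close> is \<open>q ^ r\<close>, so
      \<open>m = p * g\<close> is at least \<open>p * q ^ r\<close>.\<close>
    show "\<forall>\<^sub>F n in sequentially. p n \<le> m n / q n ^ r"
      using pq
    proof eventually_elim
      case (elim n)
      have "q n ^ r \<le> g n"
        unfolding g_def using elim by (subst sum.atLeast_Suc_atMost) (auto intro!: sum_nonneg)
      then have "p n * q n ^ r \<le> m n" unfolding m using elim by (intro mult_left_mono) auto
      then show ?case using elim by (simp add: field_simps)
    qed
    have "(\<lambda>n. m n / q n ^ r) \<longlonglongrightarrow> 0 / 1 ^ r"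
      by (intro tendsto_intros m0 q1) simp
    then show "(\<lambda>n. m n / q n ^ r) \<longlonglongrightarrow> 0" by simp
  qed simp
  \<comment> \<open>At the limit point \<open>p = 0\<close>, \<open>q = 1\<close> only the term
    \<open>j = 0\<close> survives, by \<open>0 ^ 0 = 1\<close>; the same holds for \<open>h\<close>
    below.\<close>
  have "g \<longlonglongrightarrow> (\<Sum>j = 0..r. real (Suc j) * 0 ^ j * 1 ^ (r - j))"
    unfolding g_def by (intro tendsto_intros p0 q1)
  also have "(\<Sum>j = 0..r. real (Suc j) * 0 ^ j * 1 ^ (r - j)) = 1"
    by (subst sum.atLeast_Suc_atMost) auto
  finally have g1: "g \<longlonglongrightarrow> 1" .
  have "h \<longlonglongrightarrow> (\<Sum>j = 0..r. 0 ^ j * 1 ^ (r - j))"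
    unfolding h_def by (intro tendsto_intros p0 q1)
  also have "(\<Sum>j = 0..r. 0 ^ j * 1 ^ (r - j)) = (1::real)"
    by (subst sum.atLeast_Suc_atMost) (auto intro!: sum.neutral)
  finally have h1: "h \<longlonglongrightarrow> 1" .
  have "(\<lambda>n. real n * m n / g n) \<longlonglongrightarrow> l / 1"
    using mean unfolding m_def by (intro tendsto_divide g1) auto
  moreover have "\<forall>\<^sub>F n in sequentially. real n * m n / g n = real n * p n"
    using order_tendstoD(1)[OF g1, of 0] by (auto simp: m elim: eventually_mono)
  ultimately show np: "(\<lambda>n. real n * p n) \<longlonglongrightarrow> l"
    by (auto dest: Lim_transform_eventually)
  \<comment> \<open>The exponential limit is applied with \<open>e = p * h\<close>, which is
    eventually \<open>1 - q ^ s\<close>.\<close>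
  have "(\<lambda>n. (1 - p n * h n) ^ n) \<longlonglongrightarrow> exp (- l)"
  proof (rule tendsto_power_exp_neg)
    show "(\<lambda>n. real n * (p n * h n)) \<longlonglongrightarrow> l"
      using tendsto_mult[OF np h1] by (simp add: mult.assoc)
    show "(\<lambda>n. p n * h n) \<longlonglongrightarrow> 0"
      using tendsto_mult[OF p0 h1] by simp
  qed
  moreover have "\<forall>\<^sub>F n in sequentially. (1 - p n * h n) ^ n = (q n ^ s) ^ n"
    using pq
  proof eventually_elim
    case (elim n)
    then have "1 - p n * h n = q n ^ s" unfolding split by linarith
    then show ?case by simp
  qed
  ultimately show "(\<lambda>n. (q n ^ s) ^ n) \<longlonglongrightarrow> exp (- l)"
    by (rule Lim_transform_eventually)
qed

text \<open>The mass is regrouped into the coefficient over \<open>n ^ k\<close>, the power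
  \<open>(n * p) ^ k\<close>, and \<open>(q ^ s) ^ n / q ^ k\<close>; each factor has a known
  limit.\<close>

lemma bisnomial_mass_tendsto_poisson:
  fixes p q :: "nat \<Rightarrow> real"
  assumes s: "s \<ge> 1"
    and pq: "\<forall>\<^sub>F n in sequentially. p n \<ge> 0 \<and> q n \<in> {0<..1} \<and> (\<Sum>k = 0..s. p n ^ k * q n ^ (s - k)) = 1"
    and mean: "(\<lambda>n. real n * (\<Sum>j = 0..s. real j * p n ^ j * q n ^ (s - j))) \<longlonglongrightarrow> l"
  shows "(\<lambda>n. real (bisnomial s n k) * p n ^ k * q n ^ (s * n - k)) \<longlonglongrightarrow> l ^ k / fact k * exp (- l)"
proof -
  note lims = bisnomial_parameters_limits[OF assms]
  have "(\<lambda>n. real (bisnomial s n k) / real n ^ k * (real n * p n) ^ k * ((q n ^ s) ^ n / q n ^ k))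
      \<longlonglongrightarrow> 1 / fact k * l ^ k * (exp (- l) / 1 ^ k)"
    by (intro tendsto_intros bisnomial_asymp s lims) simp
  moreover have "\<forall>\<^sub>F n in sequentially.
      real (bisnomial s n k) / real n ^ k * (real n * p n) ^ k * ((q n ^ s) ^ n / q n ^ k)
      = real (bisnomial s n k) * p n ^ k * q n ^ (s * n - k)"
    \<comment> \<open>\<open>n > 0\<close> cancels \<open>n ^ k\<close>, and
      \<open>n \<ge> k\<close> ensures \<open>k \<le> s * n\<close>, so that the exponent
      \<open>s * n - k\<close> is not truncated.\<close>
    using pq eventually_gt_at_top[of 0] eventually_ge_at_top[of k]
  proof eventually_elim
    case (elim n)
    have "k \<le> s * n" using elim s by (metis le_trans mult_le_mono1 nat_mult_1)
    then have "(q n ^ s) ^ n / q n ^ k = q n ^ (s * n - k)"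
      using elim by (simp add: power_diff power_mult)
    then show ?case using elim by (simp add: power_mult_distrib)
  qed
  ultimately show ?thesis
    by (auto dest: Lim_transform_eventually)
qed

section \<open>Random variables with values in the natural numbers\<close>

text \<open>On the space, \<open>X\<close> is the finite sum of \<open>k\<close> times the indicator
  of the event \<open>X = k\<close>, which is integrated term by term.\<close>

lemma (in prob_space) integral_bounded_nat:
  fixes X :: "'a \<Rightarrow> nat"
  assumes X: "X \<in> measurable M (count_space UNIV)"
    and bound: "\<And>\<omega>. \<omega> \<in> space M \<Longrightarrow> X \<omega> \<le> N"
  shows "(\<integral>\<omega>. real (X \<omega>) \<partial>M) = (\<Sum>k\<le>N. real k * \<P>(\<omega> in M. X \<omega> = k))"
proof -
  have meas: "{\<omega> \<in> space M. X \<omega> = k} \<in> sets M" for k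
    using X by measurable
  have "(\<integral>\<omega>. real (X \<omega>) \<partial>M) = (\<integral>\<omega>. (\<Sum>k\<le>N. real k * indicator {\<omega> \<in> space M. X \<omega> = k} \<omega>) \<partial>M)"
  proof (rule Bochner_Integration.integral_cong[OF refl])
    fix \<omega> assume \<omega>: "\<omega> \<in> space M"
    have "(\<Sum>k\<le>N. real k * indicator {\<omega> \<in> space M. X \<omega> = k} \<omega>)
        = (\<Sum>k\<le>N. if k = X \<omega> then real k else 0)"
      using \<omega> by (intro sum.cong) auto
    also have "\<dots> = real (X \<omega>)" using bound[OF \<omega>] by simp
    finally show "real (X \<omega>) = (\<Sum>k\<le>N. real k * indicator {\<omega> \<in> space M. X \<omega> = k} \<omega>)" by simp
  qed
  also have "\<dots> = (\<Sum>k\<le>N. \<integral>\<omega>. real k * indicator {\<omega> \<in> space M. X \<omega> = k} \<omega> \<partial>M)"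
    using meas by (intro Bochner_Integration.integral_sum) (auto simp: emeasure_eq_measure)
  also have "\<dots> = (\<Sum>k\<le>N. real k * \<P>(\<omega> in M. X \<omega> = k))"
    using meas by (intro sum.cong refl) (simp add: emeasure_eq_measure Int_absorb1)
  finally show ?thesis .
qed

text \<open>The event \<open>X \<le> x\<close> is a finite disjoint union of the events
  \<open>X = k\<close>; for negative \<open>x\<close> the union is empty.\<close>

lemma (in prob_space) cdf_distr_real_nat:
  fixes X :: "'a \<Rightarrow> nat"
  assumes X: "X \<in> measurable M (count_space UNIV)"
  shows "cdf (distr M borel (\<lambda>\<omega>. real (X \<omega>))) x
    = (\<Sum>k | real k \<le> x. \<P>(\<omega> in M. X \<omega> = k))"
proof -
  have meas: "{\<omega> \<in> space M. X \<omega> = k} \<in> sets M" for k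
    using X by measurable
  have fin: "finite {k. real k \<le> x}"
    by (rule finite_subset[of _ "{..nat \<lfloor>x\<rfloor>}"]) (auto simp: le_nat_floor)
  have "(\<lambda>\<omega>. real (X \<omega>)) \<in> borel_measurable M"
    using X by measurable
  then have "cdf (distr M borel (\<lambda>\<omega>. real (X \<omega>))) x = prob ((\<lambda>\<omega>. real (X \<omega>)) -` {..x} \<inter> space M)"
    by (simp add: cdf_def measure_distr)
  also have "(\<lambda>\<omega>. real (X \<omega>)) -` {..x} \<inter> space M = (\<Union>k\<in>{k. real k \<le> x}. {\<omega> \<in> space M. X \<omega> = k})"
    by auto
  also have "prob \<dots> = (\<Sum>k | real k \<le> x. \<P>(\<omega> in M. X \<omega> = k))"
    using meas fin by (intro finite_measure_finite_Union) (auto simp: disjoint_family_on_def)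
  finally show ?thesis .
qed

text \<open>For each \<open>x\<close> the distribution functions are sums of masses over one finite
  index set independent of \<open>n\<close>, so limits of masses add up. The spaces
  \<open>M n\<close> may vary with \<open>n\<close>.\<close>

lemma weak_conv_nat_valued:
  fixes X :: "nat \<Rightarrow> 'a \<Rightarrow> nat" and Y :: "'b \<Rightarrow> nat"
  assumes M: "\<forall>\<^sub>F n in sequentially. prob_space (M n) \<and> X n \<in> measurable (M n) (count_space UNIV)"
    and N: "prob_space N" "Y \<in> measurable N (count_space UNIV)"
    and lim: "\<And>k. (\<lambda>n. \<P>(\<omega> in M n. X n \<omega> = k)) \<longlonglongrightarrow> \<P>(\<omega> in N. Y \<omega> = k)"
  shows "weak_conv_m (\<lambda>n. distr (M n) borel (\<lambda>\<omega>. real (X n \<omega>)))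
    (distr N borel (\<lambda>\<omega>. real (Y \<omega>)))"
  unfolding weak_conv_m_def weak_conv_def
proof (intro allI impI)
  fix x
  have "(\<lambda>n. \<Sum>k | real k \<le> x. \<P>(\<omega> in M n. X n \<omega> = k)) \<longlonglongrightarrow> (\<Sum>k | real k \<le> x. \<P>(\<omega> in N. Y \<omega> = k))"
    by (intro tendsto_sum lim)
  moreover have "\<forall>\<^sub>F n in sequentially. (\<Sum>k | real k \<le> x. \<P>(\<omega> in M n. X n \<omega> = k))
      = cdf (distr (M n) borel (\<lambda>\<omega>. real (X n \<omega>))) x"
    using M by eventually_elim (simp add: prob_space.cdf_distr_real_nat)
  ultimately show "(\<lambda>n. cdf (distr (M n) borel (\<lambda>\<omega>. real (X n \<omega>))) x)
      \<longlonglongrightarrow> cdf (distr N borel (\<lambda>\<omega>. real (Y \<omega>))) x"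
    using prob_space.cdf_distr_real_nat[OF N] by (auto dest: Lim_transform_eventually)
qed

section \<open>Convergence to the Poisson distribution\<close>

theorem theorem5p2:
  fixes s :: nat
    and p q :: "nat \<Rightarrow> real"
    and M :: "nat \<Rightarrow> 'a measure"
    and X :: "nat \<Rightarrow> 'a \<Rightarrow> nat"
    and lam :: real
  assumes s: "s \<ge> 2"
    and p: "\<And>n. n \<ge> 1 \<Longrightarrow> p n \<in> {0<..<1}"
    and q: "\<And>n. n \<ge> 1 \<Longrightarrow> q n \<in> {0<..<1}"
    and pq: "\<And>n. n \<ge> 1 \<Longrightarrow> (\<Sum>k = 0..s. p n ^ k * q n ^ (s - k)) = 1"
    and prob: "\<And>n. n \<ge> 1 \<Longrightarrow> prob_space (M n)"
    and rv: "\<And>n. n \<ge> 1 \<Longrightarrow> X n \<in> measurable (M n) (count_space UNIV)"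
    and range: "\<And>n \<omega>. n \<ge> 1 \<Longrightarrow> \<omega> \<in> space (M n) \<Longrightarrow> X n \<omega> \<in> {0..s * n}"
    and law: "\<And>n k. n \<ge> 1 \<Longrightarrow> k \<le> s * n \<Longrightarrow>
      \<P>(\<omega> in M n. X n \<omega> = k) = real (bisnomial s n k) * p n ^ k * q n ^ (s * n - k)"
    and lam: "lam > 0"
    and lim: "(\<lambda>n. \<integral>\<omega>. real (X n \<omega>) \<partial>M n) \<longlonglongrightarrow> lam"
  shows "(\<forall>n\<ge>1. (\<integral>\<omega>. real (X n \<omega>) \<partial>M n) =
        (if p n \<noteq> q n
         then real n * p n * ((real (s + 1) * p n ^ s - 1) / (p n - q n))
         else real (s * n) / 2)) \<and>
    weak_conv_m (\<lambda>n. distr (M n) borel (\<lambda>\<omega>. real (X n \<omega>)))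
                (distr (measure_pmf (poisson_pmf lam)) borel real) \<and>
    (\<forall>k. (\<lambda>n. \<P>(\<omega> in M n. X n \<omega> = k)) \<longlonglongrightarrow> lam ^ k / fact k * exp (- lam)) \<and>
    (\<forall>k. (\<lambda>n. real (bisnomial s n k) * p n ^ k * q n ^ (s * n - k))
                \<longlonglongrightarrow> lam ^ k / fact k * exp (- lam))"
proof -
  let ?m = "\<lambda>n. \<Sum>j = 0..s. real j * p n ^ j * q n ^ (s - j)"
  have s1: "s \<ge> 1" using s by simp
  have EX: "(\<integral>\<omega>. real (X n \<omega>) \<partial>M n) = real n * ?m n" if n: "n \<ge> 1" for n
  proof -
    have "(\<integral>\<omega>. real (X n \<omega>) \<partial>M n) = (\<Sum>k\<le>s * n. real k * \<P>(\<omega> in M n. X n \<omega> = k))"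
      using range[OF n] by (intro prob_space.integral_bounded_nat prob rv n) auto
    also have "\<dots> = (\<Sum>k\<le>s * n. real k * (real (bisnomial s n k) * p n ^ k * q n ^ (s * n - k)))"
      using law[OF n] by (intro sum.cong) auto
    also have "\<dots> = real n * ?m n"
      \<comment> \<open>The power of the normalizing sum in the first moment equals 1.\<close>
      unfolding bisnomial_first_moment using pq[OF n] by simp
    finally show ?thesis .
  qed
  have mean: "real n * ?m n = (if p n \<noteq> q n
      then real n * p n * ((real (s + 1) * p n ^ s - 1) / (p n - q n))
      else real (s * n) / 2)" if n: "n \<ge> 1" for n
  proof (cases "p n = q n")
    case True
    \<comment> \<open>When \<open>p = q\<close> every term is \<open>q ^ s\<close>, so a single
      summand is uniform on \<open>{0..s}\<close> and has mean \<open>s / 2\<close>.\<close>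
    have "(\<Sum>k = 0..s. q n ^ k * q n ^ (s - k)) = (\<Sum>k = 0..s. q n ^ s)"
      by (intro sum.cong) (auto simp: power_add[symmetric])
    then have c: "real (s + 1) * q n ^ s = 1" using pq[OF n] True by simp
    have "?m n = (\<Sum>j = 0..s. real j) * q n ^ s"
      unfolding True sum_distrib_right
      by (intro sum.cong) (auto simp: mult.assoc power_add[symmetric])
    also have "(\<Sum>j = 0..s. real j) = real s * real (s + 1) / 2"
      using double_gauss_sum[of s, where ?'a = real] by (simp add: add.commute mult.commute)
    also have "real s * real (s + 1) / 2 * q n ^ s = real s / 2 * (real (s + 1) * q n ^ s)"
      by simp
    finally have "?m n = real s / 2" unfolding c by simp
    then show ?thesis using True by simp
  next
    case False
    have "?m n * (p n - q n) = p n * (real (s + 1) * p n ^ s - 1)"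
      unfolding mult.commute[of "?m n"] geometric_first_moment pq[OF n] ..
    then have "?m n = p n * (real (s + 1) * p n ^ s - 1) / (p n - q n)"
      using False by (intro eq_divide_imp) simp_all
    then show ?thesis using False by simp
  qed
  \<comment> \<open>The parameters are constrained from index 1 on, hence the passage to eventual
    statements.\<close>
  have ev: "\<forall>\<^sub>F n in sequentially. p n \<ge> 0 \<and> q n \<in> {0<..1} \<and> (\<Sum>k = 0..s. p n ^ k * q n ^ (s - k)) = 1"
    using eventually_ge_at_top[of 1]
    by eventually_elim (use p q pq in \<open>auto intro: less_imp_le\<close>)
  have "(\<lambda>n. real n * ?m n) \<longlonglongrightarrow> lam"
    using lim by (rule Lim_transform_eventually) (use EX in \<open>auto simp: eventually_at_top_linorder\<close>)
  from bisnomial_mass_tendsto_poisson[OF s1 ev this]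
  have mass: "(\<lambda>n. real (bisnomial s n k) * p n ^ k * q n ^ (s * n - k))
      \<longlonglongrightarrow> lam ^ k / fact k * exp (- lam)" for k .
  have pmf: "(\<lambda>n. \<P>(\<omega> in M n. X n \<omega> = k)) \<longlonglongrightarrow> lam ^ k / fact k * exp (- lam)" for k
    using mass
  proof (rule Lim_transform_eventually)
    show "\<forall>\<^sub>F n in sequentially. real (bisnomial s n k) * p n ^ k * q n ^ (s * n - k)
        = \<P>(\<omega> in M n. X n \<omega> = k)"
      \<comment> \<open>The law is given for \<open>k \<le> s * n\<close>, which holds as soon as
        \<open>n \<ge> k\<close>.\<close>
      using eventually_ge_at_top[of 1] eventually_ge_at_top[of k]
    proof eventually_elim
      case (elim n)
      have "k \<le> s * n" using elim s1 by (metis le_trans mult_le_mono1 nat_mult_1)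
      then show ?case using law elim by simp
    qed
  qed
  have "weak_conv_m (\<lambda>n. distr (M n) borel (\<lambda>\<omega>. real (X n \<omega>)))
      (distr (measure_pmf (poisson_pmf lam)) borel real)"
  proof (rule weak_conv_nat_valued)
    show "\<forall>\<^sub>F n in sequentially. prob_space (M n) \<and> X n \<in> measurable (M n) (count_space UNIV)"
      using eventually_ge_at_top[of 1] by eventually_elim (use prob rv in auto)
    \<comment> \<open>The limit variable is the identity on the Poisson space;
      \<open>lam > 0\<close> gives \<open>poisson_pmf lam\<close> its explicit mass
      function.\<close>
    show "(\<lambda>n. \<P>(\<omega> in M n. X n \<omega> = k)) \<longlonglongrightarrow> \<P>(\<omega> in measure_pmf (poisson_pmf lam). \<omega> = k)" for k
      using pmf[of k] lam by (simp add: measure_pmf_single)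
  qed (auto intro: measure_pmf.prob_space_axioms)
  then show ?thesis using EX mean pmf mass by simp
qed

end
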